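(* Let $d=1$ and let $\mathcal T$ be a complete, deterministic, subsequential transducer with input alphabet $\{0,\dots,q-1\}$ whose output labels (of transitions and final outputs) are integers, and which has a reset sequence. Assume $e_{\mathcal{T}}\notin\mathbb{Z}$. Then the function $\Psi_{1}$ is not differentiable at any $x\in\mathbb{R}$.
   Context: Let $q\ge2$. A complete, deterministic, subsequential transducer with input alphabet $\{0,\dots,q-1\}$ has finitely many states $1,\dots,S$, initial state $1$, for each state and digit exactly one outgoing transition with that input label and an output label, and a final output for each state; all states are accessible from the initial state. For $n\in\mathbb N_0$, the standard $q$-ary expansion of $n$ (without leading zeros) is read from the least significant digit; $\mathcal T(n)$ is the sum of the output labels along the path starting at the initial state plus the final output of the last state. A reset sequence is an input word such that, starting from any state and reading it, one always ends in one and the same state. Final components $C_1,\dots,C_c$: strongly connected components of the underlying digraph with no leaving arc; $p$ is the lcm of their periods. $M(t)=\sum_{\varepsilon}M_\varepsilon(t)$ where $M_\varepsilon(t)$ has $(s_1,s_2)$ entry $e^{it\delta}$ if the transition from $s_1$ with input $\varepsilon$ leads to $s_2$ with output $\delta$ and $0$ otherwise. Near $t=0$, $\mu_j(t)$ is the eigenvalue of the principal submatrix of $M(t)$ on $C_j$ with $\mu_j(0)=q$. $\boldsymbol w_0^\top$ is the image of $\boldsymbol e_1^\top$ (indicator of the initial state) under the projection onto the left eigenspace of $M(0)$ for eigenvalue $q$ along the sum of the other generalized left eigenspaces, $\lambda_j=\boldsymbol w_0^\top\boldsymbol c_j$ with $\boldsymbol c_j$ the indicator vector of $C_j$, and $e_{\mathcal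 T}=\sum_j\lambda_j(-iq^{-1}\mu_j'(0))$. $\Psi_1$ is the $p$-periodic continuous function such that, for $n$ uniform on $\{0,\dots,N-1\}$, $\mathbb E(\mathcal T(n))=e_{\mathcal T}\log_qN+\Psi_1(\log_qN)+\mathcal O(N^{-\xi}\log N)$ for some $\xi>0$. *)

theory Defs
  imports
    "HOL-Analysis.Derivative"
    "HOL-Library.Landau_Symbols"
    "Graph_Theory.Digraph_Component"
    "Jordan_Normal_Form.DL_Submatrix"
    "Jordan_Normal_Form.Matrix_Kernel"
    "Jordan_Normal_Form.Spectral_Radius"
begin

text \<open>
  The states are \<open>0, \<dots>, nstates - 1\<close>, and the initial state is \<open>0\<close>. Determinism and
  completeness are built into the use of total functions for transitions and outputs; values
  outside the states and the digits \<open>0, \<dots>, q - 1\<close> are irrelevant.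
\<close>

record transducer =
  nstates :: nat
  step :: "nat \<Rightarrow> nat \<Rightarrow> nat"
  out :: "nat \<Rightarrow> nat \<Rightarrow> real"
  final_out :: "nat \<Rightarrow> real"

definition is_transducer :: "nat \<Rightarrow> transducer \<Rightarrow> bool" where
  "is_transducer q T \<longleftrightarrow>
     0 < nstates T \<and>
     (\<forall>s<nstates T. \<forall>\<epsilon><q. step T s \<epsilon> < nstates T) \<and>
     (\<forall>s<nstates T. \<exists>w. set w \<subseteq> {..<q} \<and> foldl (step T) 0 w = s)"

definition integer_outputs :: "nat \<Rightarrow> transducer \<Rightarrow> bool" where
  "integer_outputs q T \<longleftrightarrow>
     (\<forall>s<nstates T. \<forall>\<epsilon><q. out T s \<epsilon> \<in> \<int>) \<and> (\<forall>s<nstates T. final_out T s \<in> \<int>)"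

definition is_reset_sequence :: "nat \<Rightarrow> transducer \<Rightarrow> nat list \<Rightarrow> bool" where
  "is_reset_sequence q T w \<longleftrightarrow>
     set w \<subseteq> {..<q} \<and> (\<exists>r. \<forall>s<nstates T. foldl (step T) s w = r)"

text \<open>Least significant digit first; the expansion of \<open>0\<close> is the empty word.\<close>

function digits :: "nat \<Rightarrow> nat \<Rightarrow> nat list" where
  "digits q n = (if q < 2 \<or> n = 0 then [] else (n mod q) # digits q (n div q))"
  by auto
termination by (relation "measure snd") auto

declare digits.simps [simp del]

fun output_from :: "transducer \<Rightarrow> nat \<Rightarrow> nat list \<Rightarrow> real" where
  "output_from T s [] = final_out T s"
| "output_from T s (\<epsilon> # w) = out T s \<epsilon> + output_from T (step T s \<epsilon>) w"

definition output_sum :: "nat \<Rightarrow> transducer \<Rightarrow> nat \<Rightarrow> real" where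
  "output_sum q T n = output_from T 0 (digits q n)"

definition mean_output :: "nat \<Rightarrow> transducer \<Rightarrow> nat \<Rightarrow> real" where
  "mean_output q T N = (\<Sum>n<N. output_sum q T n) / real N"

definition underlying_digraph :: "nat \<Rightarrow> transducer \<Rightarrow> (nat, nat \<times> nat) pre_digraph" where
  "underlying_digraph q T =
     \<lparr> verts = {..<nstates T}, arcs = {..<nstates T} \<times> {..<q},
       tail = fst, head = (\<lambda>(s, \<epsilon>). step T s \<epsilon>) \<rparr>"

definition final_components :: "nat \<Rightarrow> transducer \<Rightarrow> nat set set" where
  "final_components q T =
     {C \<in> pre_digraph.sccs_verts (underlying_digraph q T).
        \<forall>a \<in> arcs (underlying_digraph q T).
          tail (underlying_digraph q T) a \<in> C \<longrightarrow> head (underlying_digraph q T) a \<in> C}"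

definition component_period :: "nat \<Rightarrow> transducer \<Rightarrow> nat set \<Rightarrow> nat" where
  "component_period q T C =
     Gcd {length w | w. pre_digraph.cycle (underlying_digraph q T \<restriction> C) w}"

definition final_period :: "nat \<Rightarrow> transducer \<Rightarrow> nat" where
  "final_period q T = Lcm (component_period q T ` final_components q T)"

definition digit_matrix :: "transducer \<Rightarrow> nat \<Rightarrow> real \<Rightarrow> complex mat" where
  "digit_matrix T \<epsilon> t =
     mat (nstates T) (nstates T)
       (\<lambda>(s1, s2). if step T s1 \<epsilon> = s2 then exp (\<i> * of_real t * of_real (out T s1 \<epsilon>)) else 0)"

definition transition_matrix :: "nat \<Rightarrow> transducer \<Rightarrow> real \<Rightarrow> complex mat" where
  "transition_matrix q T t =
     mat (nstates T) (nstates T) (\<lambda>ij. \<Sum>\<epsilon><q. digit_matrix T \<epsilon> t $$ ij)"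

text \<open>
  For a final component \<open>C\<close>, the number \<open>q\<close> is a simple eigenvalue of the principal submatrix
  at \<open>t = 0\<close>, so any two functions satisfying the following predicate agree in a neighbourhood
  of \<open>0\<close>; in particular the derivative at \<open>0\<close> does not depend on the choice made below.
\<close>

definition is_dominant_eigenvalue ::
    "nat \<Rightarrow> transducer \<Rightarrow> nat set \<Rightarrow> (real \<Rightarrow> complex) \<Rightarrow> bool" where
  "is_dominant_eigenvalue q T C \<mu> \<longleftrightarrow>
     \<mu> 0 = of_nat q \<and> isCont \<mu> 0 \<and>
     (\<forall>\<^sub>F t in nhds 0. eigenvalue (submatrix (transition_matrix q T t) C C) (\<mu> t))"

definition dominant_eigenvalue :: "nat \<Rightarrow> transducer \<Rightarrow> nat set \<Rightarrow> real \<Rightarrow> complex" where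
  "dominant_eigenvalue q T C = (SOME \<mu>. is_dominant_eigenvalue q T C \<mu>)"

definition left_eigenspace :: "complex mat \<Rightarrow> complex \<Rightarrow> complex vec set" where
  "left_eigenspace A k = mat_kernel (char_matrix (transpose_mat A) k)"

definition left_generalized_eigenspace :: "complex mat \<Rightarrow> complex \<Rightarrow> complex vec set" where
  "left_generalized_eigenspace A k = (\<Union>m. mat_kernel (char_matrix (transpose_mat A) k ^\<^sub>m m))"

text \<open>
  \<open>is_left_projection A k v w\<close>: the vector \<open>w\<close> is the component of \<open>v\<close> in the left eigenspace
  for \<open>k\<close>, along the sum of the generalized left eigenspaces of the other eigenvalues.
\<close>

definition is_left_projection ::
    "complex mat \<Rightarrow> complex \<Rightarrow> complex vec \<Rightarrow> complex vec \<Rightarrow> bool" where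
  "is_left_projection A k v w \<longleftrightarrow>
     w \<in> left_eigenspace A k \<and>
     (\<exists>u. (\<forall>l \<in> spectrum (transpose_mat A) - {k}. u l \<in> left_generalized_eigenspace A l) \<and>
          (\<forall>i<dim_vec v. vec_index v i =
             vec_index w i + (\<Sum>l \<in> spectrum (transpose_mat A) - {k}. vec_index (u l) i)))"

text \<open>
  The eigenvalue \<open>q\<close> of the matrix at \<open>t = 0\<close> is semisimple, since this matrix is nonnegative
  with all row sums equal to \<open>q\<close>; hence the following projection exists and is unique.
\<close>

definition w0 :: "nat \<Rightarrow> transducer \<Rightarrow> complex vec" where
  "w0 q T =
     (THE w. is_left_projection (transition_matrix q T 0) (of_nat q) (unit_vec (nstates T) 0) w)"

definition component_weight :: "nat \<Rightarrow> transducer \<Rightarrow> nat set \<Rightarrow> complex" where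
  "component_weight q T C =
     scalar_prod (w0 q T) (vec (nstates T) (\<lambda>s. if s \<in> C then 1 else 0))"

definition e_T :: "nat \<Rightarrow> transducer \<Rightarrow> complex" where
  "e_T q T =
     (\<Sum>C \<in> final_components q T.
        component_weight q T C *
        (- \<i> * inverse (of_nat q) * vector_derivative (dominant_eigenvalue q T C) (at 0)))"

text \<open>
  At most one function has the following property, because the numbers \<open>log q N\<close> are dense
  modulo the period and the function is continuous. The number \<open>e_T q T\<close> is real but is
  given by a complex expression, so the expansion is stated in the complex numbers.
\<close>

definition is_Psi1 :: "nat \<Rightarrow> transducer \<Rightarrow> (real \<Rightarrow> real) \<Rightarrow> bool" where
  "is_Psi1 q T \<Psi> \<longleftrightarrow>
     (\<forall>x. \<Psi> (x + real (final_period q T)) = \<Psi> x) \<and>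
     continuous_on UNIV \<Psi> \<and>
     (\<exists>\<xi>>0. (\<lambda>N::nat. norm (complex_of_real (mean_output q T N)
                 - e_T q T * complex_of_real (log (real q) (real N))
                 - complex_of_real (\<Psi> (log (real q) (real N)))))
             \<in> O(\<lambda>N. real N powr (-\<xi>) * ln (real N)))"

end

theory Submission
  imports Defs "HOL-Analysis.Complex_Transcendental"
begin

text \<open>
  A reset word forces every final component to be aperiodic, so \<open>\<Psi>\<close> has period \<open>1\<close>, and
  \<open>F u = u * (e * log q u + \<Psi> (log q u))\<close> satisfies \<open>F (q ^ k * u) = q ^ k * (F u + k * e * u)\<close>.
  Let \<open>c\<close> be an integer whose expansion consists of the reset word in the low positions, followed
  by the digits of \<open>a\<close>. The outputs of the integers in \<open>[c * q ^ j, (c + 1) * q ^ j)\<close> add up to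
  \<open>d j + q ^ j * b a\<close>, where \<open>b a\<close> is an integer and \<open>d j\<close> does not depend on \<open>a\<close>. Dividing by
  \<open>q ^ j\<close> and letting \<open>j\<close> tend to infinity shows that \<open>F (c + 1) - F c - b a\<close> does not depend
  on \<open>a\<close>. If \<open>\<Psi>\<close> is differentiable at \<open>x\<close>, then choosing \<open>c\<close> within a bounded distance
  of \<open>q powr (x + k)\<close> gives \<open>F (c + 1) - F c = k * e + F' (q powr x) + o(1)\<close>. So \<open>k * e - b a\<close>
  converges as \<open>k\<close> grows, and taking differences exhibits \<open>e\<close> as a limit of integers.
\<close>

section \<open>Aperiodicity of the final components\<close>

text \<open>Component periods are defined from cycles, while words only yield closed walks. If the
  vertices after the first arc repeat, a nonempty closed walk can be cut out; both it and the
  remaining closed walk are shorter, and their lengths add up.\<close>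

lemma (in wf_digraph) dvd_length_closed_awalk:
  assumes cyc: "\<And>p. cycle p \<Longrightarrow> d dvd length p"
    and "awalk u p u"
  shows "d dvd length p"
  using assms(2)
proof (induction "length p" arbitrary: u p rule: less_induct)
  case less
  show ?case
  proof (cases p)
    case Nil
    then show ?thesis by simp
  next
    case (Cons e p')
    with less.prems have e: "e \<in> arcs G" "tail G e = u" and p': "awalk (head G e) p' u"
      by (auto simp: awalk_Cons_iff)
    show ?thesis
    proof (cases "distinct (awalk_verts (head G e) p')")
      case True
      then have "cycle p"
        unfolding cycle_def using less.prems Cons by (intro exI[of _ u]) auto
      then show ?thesis by (rule cyc)
    next
      case False
      from awalk_not_distinct_decomp[OF p' False] obtain a b c x
        where abc: "p' = a @ b @ c" "0 < length b"
          "awalk (head G e) a x" "awalk x b x" "awalk x c u"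
        by blast
      have "awalk u (e # a @ c) u"
        using abc e by (metis awalk_Cons_iff awalk_appendI)
      with abc Cons have "d dvd length (e # a @ c)" by (intro less.hyps) auto
      moreover from abc Cons have "d dvd length b" by (intro less.hyps[of _ x]) auto
      moreover have "length p = length (e # a @ c) + length b"
        using abc Cons by simp
      ultimately show ?thesis by (metis dvd_add)
    qed
  qed
qed

lemma foldl_step_in:
  assumes "is_transducer q T" "s < nstates T" "set w \<subseteq> {..<q}"
  shows "foldl (step T) s w < nstates T"
  using assms(2,3)
proof (induction w arbitrary: s)
  case (Cons a w)
  then have "step T s a < nstates T" using assms(1) by (auto simp: is_transducer_def)
  with Cons show ?case by simp
qed simp

lemma wf_underlying_digraph:
  assumes "is_transducer q T"
  shows "wf_digraph (underlying_digraph q T)"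
  using assms by unfold_locales (auto simp: underlying_digraph_def is_transducer_def)

text \<open>No arc leaves a final component, so the run stays inside \<open>C\<close> and is a walk
  of the induced subgraph, where the period is measured.\<close>

lemma word_awalk_final_component:
  assumes T: "is_transducer q T" and C: "C \<in> final_components q T"
    and "s \<in> C" "set w \<subseteq> {..<q}"
  shows "\<exists>p. length p = length w \<and>
    pre_digraph.awalk (underlying_digraph q T \<restriction> C) s p (foldl (step T) s w)"
  using assms(3,4)
proof (induction w arbitrary: s)
  case Nil
  then show ?case by (auto simp: pre_digraph.awalk_def pre_digraph.cas.simps)
next
  case (Cons a w)
  let ?G = "underlying_digraph q T"
  interpret G: wf_digraph ?G by (rule wf_underlying_digraph[OF T])
  have "C \<in> G.sccs_verts" using C by (simp add: final_components_def)
  then have "s \<rightarrow>\<^sup>*\<^bsub>?G\<^esub> s" using Cons.prems by (auto simp: G.in_sccs_verts_conv_reachable)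
  then have "s < nstates T"
    using G.reachable_in_verts(1)[of s s] by (simp add: underlying_digraph_def)
  then have arc: "(s, a) \<in> arcs ?G" using Cons.prems by (auto simp: underlying_digraph_def)
  with C Cons.prems have sC: "step T s a \<in> C"
    by (force simp: final_components_def underlying_digraph_def)
  from Cons.IH[OF this] Cons.prems obtain p where p: "length p = length w"
    "pre_digraph.awalk (?G \<restriction> C) (step T s a) p (foldl (step T) (step T s a) w)" by auto
  have "pre_digraph.awalk (?G \<restriction> C) s ((s, a) # p) (foldl (step T) s (a # w))"
    using p(2) arc sC Cons.prems
    by (auto simp: pre_digraph.awalk_def pre_digraph.cas.simps underlying_digraph_def)
  with p(1) show ?case by (intro exI[of _ "(s, a) # p"]) auto
qed

text \<open>
  From a state \<open>s\<close> of a final component, both the reset word and the reset word preceded by a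
  \<open>0\<close> lead to the same state, and so there are closed walks of two consecutive lengths.
\<close>

lemma component_period_eq_1:
  assumes T: "is_transducer q T" and q: "q > 0" and w: "is_reset_sequence q T w"
    and C: "C \<in> final_components q T"
  shows "component_period q T C = 1"
proof -
  let ?G = "underlying_digraph q T"
  interpret G: wf_digraph ?G by (rule wf_underlying_digraph[OF T])
  have scc: "C \<in> G.sccs_verts" using C by (simp add: final_components_def)
  interpret M: max_reachable_set ?G C by unfold_locales (rule scc)
  interpret H: wf_digraph "?G \<restriction> C" by (rule G.wellformed_induce_subgraph)
  obtain s where s: "s \<in> C" using M.not_empty by auto
  have "s < nstates T"
    using G.reachable_in_verts(1)[OF M.reach_in[OF s s]] by (simp add: underlying_digraph_def)
  moreover have "step T s 0 < nstates T"
    using T q calculation by (auto simp: is_transducer_def)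
  moreover obtain r where "\<forall>s<nstates T. foldl (step T) s w = r" and wq: "set w \<subseteq> {..<q}"
    using w by (auto simp: is_reset_sequence_def)
  ultimately have r: "foldl (step T) s w = r" "foldl (step T) s (0 # w) = r" by auto
  from word_awalk_final_component[OF T C s wq] r obtain p1
    where p1: "length p1 = length w" "H.awalk s p1 r" by auto
  from word_awalk_final_component[OF T C s, of "0 # w"] wq q r obtain p2
    where p2: "length p2 = Suc (length w)" "H.awalk s p2 r" by auto
  have "r \<in> C" using H.awalk_last_in_verts[OF p1(2)] by simp
  then have "r \<rightarrow>\<^sup>*\<^bsub>?G \<restriction> C\<^esub> s" using M.strongly_connected s by auto
  then obtain p where p: "H.awalk r p s" by (auto simp: H.reachable_awalk)
  let ?d = "component_period q T C"
  have cyc: "?d dvd length c" if "H.cycle c" for c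
    unfolding component_period_def using that by (intro Gcd_dvd) auto
  have "?d dvd length (p1 @ p)" "?d dvd length (p2 @ p)"
    using H.dvd_length_closed_awalk[OF cyc] H.awalk_appendI p1 p2 p by blast+
  then have "?d dvd length (p2 @ p) - length (p1 @ p)" by (rule dvd_diff_nat[rotated])
  then show ?thesis using p1 p2 by simp
qed

lemma final_period_eq_1:
  assumes "is_transducer q T" "q > 0" "is_reset_sequence q T w"
  shows "final_period q T = 1"
proof -
  \<comment> \<open>The inclusion also covers an empty family of components, whose
    \<open>Lcm\<close> is 1 as well.\<close>
  have "component_period q T ` final_components q T \<subseteq> {1}"
    using component_period_eq_1[OF assms] by auto
  from subset_singletonD[OF this] show ?thesis
    unfolding final_period_def by (elim disjE) (simp_all only: Lcm_empty Lcm_singleton normalize_nat_def id_apply)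
qed

section \<open>Output sums over blocks\<close>

text \<open>Positivity of \<open>a\<close> puts a nonzero digit above \<open>u\<close>, so zeros at
  the end of \<open>u\<close> are not dropped as leading zeros.\<close>

lemma digits_horner_sum_append:
  assumes "q \<ge> 2" "a > 0" "set u \<subseteq> {..<q}"
  shows "digits q (horner_sum id q u + q ^ length u * a) = u @ digits q a"
  using assms(3)
proof (induction u)
  case (Cons d u)
  let ?n = "horner_sum id q u + q ^ length u * a"
  have eq: "horner_sum id q (d # u) + q ^ length (d # u) * a = d + q * ?n"
    by (simp add: algebra_simps)
  have nz: "d + q * ?n \<noteq> 0" using assms(1,2) by auto
  have "d < q" using Cons.prems by simp
  then have "(d + q * ?n) mod q = d" "(d + q * ?n) div q = ?n" by simp_all
  then have "digits q (d + q * ?n) = d # digits q ?n"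
    using nz assms(1) by (subst digits.simps) (simp only: if_False not_less[symmetric] simp_thms)
  moreover have "digits q ?n = u @ digits q a" by (rule Cons.IH) (use Cons.prems in simp)
  ultimately show ?case unfolding eq by (simp only: append_Cons)
qed simp

text \<open>Unlike in \<open>digits\<close>, zeros at the high end are kept: every
  \<open>m < q ^ j\<close> gives a word of length exactly \<open>j\<close> that can be read before
  the reset word.\<close>

definition padded_digits :: "nat \<Rightarrow> nat \<Rightarrow> nat \<Rightarrow> nat list" where
  "padded_digits q j m = map (\<lambda>i. m div q ^ i mod q) [0..<j]"

lemma horner_sum_padded_digits: "horner_sum id q (padded_digits q j m) = m mod q ^ j"
proof (induction j)
  case (Suc j)
  have "padded_digits q (Suc j) m = padded_digits q j m @ [m div q ^ j mod q]"
    by (simp add: padded_digits_def)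
  moreover have "m mod q ^ Suc j = q ^ j * (m div q ^ j mod q) + m mod q ^ j"
    by (metis mod_mult2_eq power_Suc2)
  ultimately show ?case using Suc
    by (simp add: horner_sum_append) (simp add: padded_digits_def)
qed (simp add: padded_digits_def)

text \<open>The final output is left out because it is due only once, after the whole word; this
  allows splitting at a concatenation.\<close>

primrec path_output :: "transducer \<Rightarrow> nat \<Rightarrow> nat list \<Rightarrow> real" where
  "path_output T s [] = 0"
| "path_output T s (\<epsilon> # w) = out T s \<epsilon> + path_output T (step T s \<epsilon>) w"

lemma output_from_append:
  "output_from T s (u @ v) = path_output T s u + output_from T (foldl (step T) s u) v"
  by (induction u arbitrary: s) auto

lemma output_from_Ints:
  assumes "is_transducer q T" "integer_outputs q T" "s < nstates T" "set w \<subseteq> {..<q}"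
  shows "output_from T s w \<in> \<int>"
  using assms(3,4)
proof (induction w arbitrary: s)
  case Nil
  then show ?case using assms(2) by (auto simp: integer_outputs_def)
next
  case (Cons a w)
  then have "step T s a < nstates T" using assms(1) by (auto simp: is_transducer_def)
  then show ?case using Cons assms(2) by (auto simp: integer_outputs_def)
qed

lemma set_digits: "set (digits q n) \<subseteq> {..<q}"
proof (induction q n rule: digits.induct)
  case (1 q n)
  then show ?case by (subst digits.simps) auto
qed

text \<open>The \<open>j\<close> low digits lead to some state, \<open>w\<close> resets it to
  \<open>r\<close>, and the digits of \<open>a\<close> are then read from \<open>r\<close>. What is
  output up to the reset depends on the low digits alone and is collected in \<open>d j\<close>; the
  rest is the same for all \<open>q ^ j\<close> members of the block.\<close>

lemma block_sum_reset:
  fixes q :: nat and T :: transducer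
  assumes q: "q \<ge> 2" and T: "is_transducer q T"
    and w: "set w \<subseteq> {..<q}" "\<And>s. s < nstates T \<Longrightarrow> foldl (step T) s w = r"
  obtains d where "\<And>j a. a > 0 \<Longrightarrow>
    (\<Sum>n < (a * q ^ length w + horner_sum id q w + 1) * q ^ j. output_sum q T n)
    - (\<Sum>n < (a * q ^ length w + horner_sum id q w) * q ^ j. output_sum q T n)
    = d j + real q ^ j * output_from T r (digits q a)"
proof -
  define h where
    "h j m = (let u = padded_digits q j m
       in path_output T 0 u + path_output T (foldl (step T) 0 u) w)" for j m
  show thesis
  proof (rule that[of "\<lambda>j. \<Sum>m<q ^ j. h j m"])
    fix j a :: nat
    assume a: "a > 0"
    define c where "c = a * q ^ length w + horner_sum id q w"
    have q0: "q > 0" using q by simp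
    have val: "output_sum q T (c * q ^ j + m) = h j m + output_from T r (digits q a)"
      if "m < q ^ j" for m
    proof -
      let ?u = "padded_digits q j m"
      have u: "set ?u \<subseteq> {..<q}" "length ?u = j" using q0 by (auto simp: padded_digits_def)
      have c0: "c > 0" using a q0 by (simp add: c_def)
      have "c * q ^ j + m = horner_sum id q ?u + q ^ length ?u * c"
        using that u by (simp add: horner_sum_padded_digits)
      then have "digits q (c * q ^ j + m) = ?u @ digits q c"
        using digits_horner_sum_append[OF q c0 u(1)] by simp
      moreover have "digits q c = w @ digits q a"
        using digits_horner_sum_append[OF q a w(1)] by (simp add: c_def algebra_simps)
      moreover have "foldl (step T) 0 ?u < nstates T"
        using T u by (intro foldl_step_in[OF T]) (auto simp: is_transducer_def)
      ultimately show ?thesis using w(2)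
        by (simp add: output_sum_def output_from_append h_def Let_def)
    qed
    have "(\<Sum>n<(c + 1) * q ^ j. output_sum q T n)
        = (\<Sum>m<c + 1. \<Sum>n=m * q ^ j..<m * q ^ j + q ^ j. output_sum q T n)"
      by (rule sum.nat_group[symmetric])
    also have "\<dots> = (\<Sum>m<c. \<Sum>n=m * q ^ j..<m * q ^ j + q ^ j. output_sum q T n)
        + (\<Sum>n=c * q ^ j..<c * q ^ j + q ^ j. output_sum q T n)" by simp
    also have "(\<Sum>m<c. \<Sum>n=m * q ^ j..<m * q ^ j + q ^ j. output_sum q T n)
        = (\<Sum>n<c * q ^ j. output_sum q T n)"
      by (rule sum.nat_group)
    also have "(\<Sum>n=c * q ^ j..<c * q ^ j + q ^ j. output_sum q T n)
        = (\<Sum>m<q ^ j. output_sum q T (c * q ^ j + m))"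
      using sum.shift_bounds_nat_ivl[of "output_sum q T" 0 "c * q ^ j" "q ^ j"]
      by (simp add: atLeast0LessThan add.commute)
    also have "\<dots> = (\<Sum>m<q ^ j. h j m + output_from T r (digits q a))"
      by (intro sum.cong) (auto simp: val)
    finally show "(\<Sum>n < (a * q ^ length w + horner_sum id q w + 1) * q ^ j. output_sum q T n)
      - (\<Sum>n < (a * q ^ length w + horner_sum id q w) * q ^ j. output_sum q T n)
      = (\<Sum>m<q ^ j. h j m) + real q ^ j * output_from T r (digits q a)"
      by (simp add: c_def sum.distrib)
  qed
qed

section \<open>Differentiability forces an integer growth constant\<close>

text \<open>Both points may lie on the same side of \<open>y\<close>; the bounds with
  \<open>K\<close> keep their gap comparable to their distances from \<open>y\<close>.\<close>

lemma difference_quotient_tendsto: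
  fixes f :: "real \<Rightarrow> real" and \<alpha> \<beta> :: "nat \<Rightarrow> real"
  assumes f: "(f has_field_derivative D) (at y)"
    and lim: "\<alpha> \<longlonglongrightarrow> y" "\<beta> \<longlonglongrightarrow> y"
    and less: "\<And>i. \<alpha> i < \<beta> i"
    and K: "\<And>i. \<bar>\<alpha> i - y\<bar> \<le> K * (\<beta> i - \<alpha> i)" "\<And>i. \<bar>\<beta> i - y\<bar> \<le> K * (\<beta> i - \<alpha> i)"
  shows "(\<lambda>i. (f (\<beta> i) - f (\<alpha> i)) / (\<beta> i - \<alpha> i)) \<longlonglongrightarrow> D"
proof -
  \<comment> \<open>Caratheodory's slope function: each endpoint contributes a slope error tending
    to 0 times a ratio bounded by \<open>K\<close>.\<close>
  from f obtain g where g: "\<And>z. f z - f y = g z * (z - y)" "isCont g y" "g y = D"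
    unfolding CARAT_DERIV by blast
  have null: "(\<lambda>i. (g (\<gamma> i) - D) * ((\<gamma> i - y) / (\<beta> i - \<alpha> i))) \<longlonglongrightarrow> 0"
    if "\<gamma> \<longlonglongrightarrow> y" "\<And>i. \<bar>\<gamma> i - y\<bar> \<le> K * (\<beta> i - \<alpha> i)" for \<gamma>
  proof -
    have "(\<lambda>i. g (\<gamma> i) - D) \<longlonglongrightarrow> D - D"
      by (intro tendsto_intros) (use isCont_tendsto_compose[OF g(2) that(1)] g(3) in simp)
    from tendsto_mult_left_zero[OF tendsto_rabs_zero[OF this[simplified diff_self]], of K]
    have lim: "(\<lambda>i. \<bar>g (\<gamma> i) - D\<bar> * K) \<longlonglongrightarrow> 0" .
    have bound: "norm ((g (\<gamma> i) - D) * ((\<gamma> i - y) / (\<beta> i - \<alpha> i))) \<le> \<bar>g (\<gamma> i) - D\<bar> * K" for i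
    proof -
      have "\<bar>(\<gamma> i - y) / (\<beta> i - \<alpha> i)\<bar> \<le> K"
        using that(2)[of i] less[of i] by (simp add: abs_divide field_simps)
      then show ?thesis by (simp only: real_norm_def abs_mult) (intro mult_left_mono, auto)
    qed
    show ?thesis
      by (rule Lim_null_comparison[OF always_eventually[OF allI[OF bound]] lim])
  qed
  have "(f (\<beta> i) - f (\<alpha> i)) / (\<beta> i - \<alpha> i) = D
      + (g (\<beta> i) - D) * ((\<beta> i - y) / (\<beta> i - \<alpha> i))
      - (g (\<alpha> i) - D) * ((\<alpha> i - y) / (\<beta> i - \<alpha> i))" for i
  proof -
    have "f (\<beta> i) - f (\<alpha> i) = g (\<beta> i) * (\<beta> i - y) - g (\<alpha> i) * (\<alpha> i - y)"
      using g(1)[of "\<beta> i"] g(1)[of "\<alpha> i"] by simp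
    also have "\<dots> = D * (\<beta> i - \<alpha> i) + (g (\<beta> i) - D) * (\<beta> i - y) - (g (\<alpha> i) - D) * (\<alpha> i - y)"
      by (simp add: algebra_simps)
    finally have "(f (\<beta> i) - f (\<alpha> i)) / (\<beta> i - \<alpha> i) = D * (\<beta> i - \<alpha> i) / (\<beta> i - \<alpha> i)
        + (g (\<beta> i) - D) * (\<beta> i - y) / (\<beta> i - \<alpha> i) - (g (\<alpha> i) - D) * (\<alpha> i - y) / (\<beta> i - \<alpha> i)"
      by (simp only: add_divide_distrib[of "_ * _"] diff_divide_distrib[of "_ + _"])
    then show ?thesis using less[of i] by simp
  qed
  moreover have "(\<lambda>i. D + (g (\<beta> i) - D) * ((\<beta> i - y) / (\<beta> i - \<alpha> i))
      - (g (\<alpha> i) - D) * ((\<alpha> i - y) / (\<beta> i - \<alpha> i))) \<longlonglongrightarrow> D + 0 - 0"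
    using null lim K by (intro tendsto_intros) blast+
  ultimately show ?thesis by simp
qed

text \<open>The analytic half, in which the transducer appears only through \<open>block\<close> and
  \<open>b\<close>. It is decisive that \<open>d\<close> depends on \<open>j\<close> alone and
  \<open>b\<close> on \<open>a\<close> alone.\<close>

lemma growth_constant_Ints:
  fixes S :: "nat \<Rightarrow> real" and \<Psi> :: "real \<Rightarrow> real" and e :: real
  assumes q: "q \<ge> 2"
    and S: "(\<lambda>N. S N / real N - e * log q N - \<Psi> (log q N)) \<longlonglongrightarrow> 0"
    and per: "\<And>x. \<Psi> (x + 1) = \<Psi> x"
    and block: "\<And>j a. a > 0 \<Longrightarrow> S ((a * q ^ L + v + 1) * q ^ j) - S ((a * q ^ L + v) * q ^ j)
      = d j + real q ^ j * b a"
    and b: "\<And>a. b a \<in> \<int>"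
    and diff: "\<Psi> differentiable (at x)"
  shows "e \<in> \<int>"
proof -
  \<comment> \<open>\<open>F\<close> is the main term of \<open>S\<close>: for positive
    \<open>N\<close>, \<open>S N\<close> equals \<open>F N + N * R N\<close>, and \<open>R\<close>
    tends to 0.\<close>
  define F where "F u = u * (e * log q u + \<Psi> (log q u))" for u :: real
  define R where "R N = S N / real N - e * log q N - \<Psi> (log q N)" for N :: nat
  define y where "y = real q powr x"
  \<comment> \<open>The floor keeps \<open>c i\<close> within a bounded distance of
    \<open>q ^ (i + L) * y\<close> while leaving its low part equal to \<open>v\<close>. Rescaling
    the neighbours \<open>c i\<close> and \<open>c i + 1\<close> gives two points close to
    \<open>y\<close>.\<close>
  define a where "a i = nat \<lfloor>real q ^ i * y\<rfloor>" for i
  define c where "c i = a i * q ^ L + v" for i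
  define \<alpha> where "\<alpha> i = real (c i) / real q ^ (i + L)" for i
  define \<beta> where "\<beta> i = (real (c i) + 1) / real q ^ (i + L)" for i
  have q1: "real q > 1" using q by simp
  have y0: "y > 0" using q by (simp add: y_def)

  have per_nat: "\<Psi> (x + real k) = \<Psi> x" for x k
    by (induction k) (auto simp: per add.assoc[symmetric] add.commute[of 1])
  have F_scale: "F (real q ^ k * u) = real q ^ k * (F u + real k * e * u)" if "u > 0" for k u
  proof -
    have "log q (real q ^ k * u) = log q u + real k"
      using q1 that by (simp add: log_mult log_nat_power)
    then show ?thesis by (simp add: F_def per_nat) (simp add: algebra_simps)
  qed
  have S_eq: "S (n * q ^ j) = real q ^ j * (F (real n) + real j * e * real n + real n * R (n * q ^ j))"
    if "n > 0" for n j
  proof -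
    have "n * q ^ j > 0" using that q by simp
    then have "S (n * q ^ j) = F (real (n * q ^ j)) + real (n * q ^ j) * R (n * q ^ j)"
      by (simp add: F_def R_def field_simps del: of_nat_mult of_nat_power)
    also have "real (n * q ^ j) = real q ^ j * real n" by simp
    finally show ?thesis using that by (simp only: F_scale of_nat_0_less_iff) (simp add: algebra_simps)
  qed

  \<comment> \<open>The sequence does not involve \<open>i\<close>, so uniqueness of limits will
    make its limit independent of \<open>i\<close>. The remainders vanish because \<open>c i\<close>
    is fixed while \<open>j\<close> grows.\<close>
  have lim_d: "(\<lambda>j. d j / real q ^ j - real j * e) \<longlonglongrightarrow> F (real (c i) + 1) - F (real (c i)) - b (a i)"
    if ai: "a i > 0" for i
  proof -
    have c0: "c i > 0" using ai q by (simp add: c_def)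
    have eq: "d j / real q ^ j - real j * e = F (real (c i) + 1) - F (real (c i)) - b (a i)
        + (real (c i) + 1) * R ((c i + 1) * q ^ j) - real (c i) * R (c i * q ^ j)" for j
    proof -
      have qj: "real q ^ j > 0" using q1 by simp
      note S_eq[of "c i + 1" j, unfolded of_nat_add of_nat_1] S_eq[OF c0, of j]
      moreover have "S ((c i + 1) * q ^ j) - S (c i * q ^ j) = d j + real q ^ j * b (a i)"
        using block[OF ai] by (simp add: c_def)
      ultimately have "d j = real q ^ j * (F (real (c i) + 1) - F (real (c i)) - b (a i)
        + (real (c i) + 1) * R ((c i + 1) * q ^ j) - real (c i) * R (c i * q ^ j) + real j * e)"
        by (simp add: algebra_simps)
      then show ?thesis using qj by simp
    qed
    have R0: "(\<lambda>j. R (k * q ^ j)) \<longlonglongrightarrow> 0" if "k > 0" for k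
    proof -
      have "strict_mono (\<lambda>j. k * q ^ j)"
        using that q by (intro strict_monoI) simp
      from LIMSEQ_subseq_LIMSEQ[OF _ this, of R 0] S show ?thesis
        by (simp add: R_def[abs_def] o_def)
    qed
    have "(\<lambda>j. F (real (c i) + 1) - F (real (c i)) - b (a i)
        + (real (c i) + 1) * R ((c i + 1) * q ^ j) - real (c i) * R (c i * q ^ j))
       \<longlonglongrightarrow> F (real (c i) + 1) - F (real (c i)) - b (a i) + (real (c i) + 1) * 0 - real (c i) * 0"
      using R0[of "c i + 1"] R0[OF c0] by (intro tendsto_intros) simp_all
    then show ?thesis by (simp add: eq)
  qed

  \<comment> \<open>\<open>block\<close> applies only to positive \<open>a\<close>, which the floor
    guarantees once \<open>q ^ i * y > 1\<close>.\<close>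
  obtain i0 where "1 / y < real q ^ i0" using real_arch_pow[OF q1] by blast
  have i0: "a i > 0" if "i \<ge> i0" for i
  proof -
    have "1 / y < real q ^ i"
      using \<open>1 / y < real q ^ i0\<close> power_increasing[OF that, of "real q"] q1 by linarith
    then have "1 < real q ^ i * y" using y0 by (simp add: field_simps)
    then show ?thesis by (simp add: a_def)
  qed
  define \<kappa> where "\<kappa> = F (real (c i0) + 1) - F (real (c i0)) - b (a i0)"
  have const: "F (real (c i) + 1) - F (real (c i)) - b (a i) = \<kappa>" if "i \<ge> i0" for i
    using LIMSEQ_unique[OF lim_d lim_d] i0 that by (auto simp: \<kappa>_def)

  \<comment> \<open>Rounding down costs at most \<open>q ^ L\<close>; the low part adds
    \<open>v\<close> and the offset \<open>\<theta>\<close> at most 1.\<close>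
  define K where "K = real q ^ L + real v + 1"
  have close: "\<bar>real (c i) + \<theta> - real q ^ (i + L) * y\<bar> \<le> K" if "0 \<le> \<theta>" "\<theta> \<le> 1" for i \<theta>
  proof -
    have "real (a i) \<le> real q ^ i * y" "real q ^ i * y < real (a i) + 1"
      using y0 by (auto simp: a_def)
    then have "real (a i) * real q ^ L \<le> real q ^ i * y * real q ^ L"
      "real q ^ i * y * real q ^ L \<le> (real (a i) + 1) * real q ^ L"
      using q1 by (auto intro!: mult_right_mono)
    then show ?thesis using that by (simp add: c_def K_def power_add algebra_simps)
  qed
  have gap: "\<beta> i - \<alpha> i = 1 / real q ^ (i + L)" for i
    by (simp add: \<alpha>_def \<beta>_def add_divide_distrib)
  have near: "\<bar>\<alpha> i - y\<bar> \<le> K * (\<beta> i - \<alpha> i)" "\<bar>\<beta> i - y\<bar> \<le> K * (\<beta> i - \<alpha> i)" for i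
  proof -
    have p: "real q ^ (i + L) > 0" using q1 by simp
    have "\<bar>(real (c i) + \<theta>) / real q ^ (i + L) - y\<bar> \<le> K * (1 / real q ^ (i + L))"
      if "0 \<le> \<theta>" "\<theta> \<le> 1" for \<theta>
    proof -
      have "(real (c i) + \<theta>) / real q ^ (i + L) - y
          = (real (c i) + \<theta> - real q ^ (i + L) * y) / real q ^ (i + L)"
        using p by (simp add: field_simps)
      then show ?thesis using close[OF that, of i] p by (simp add: abs_divide divide_right_mono)
    qed
    from this[of 0] this[of 1]
    show "\<bar>\<alpha> i - y\<bar> \<le> K * (\<beta> i - \<alpha> i)" "\<bar>\<beta> i - y\<bar> \<le> K * (\<beta> i - \<alpha> i)"
      unfolding gap by (simp_all add: \<alpha>_def \<beta>_def)
  qed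
  have gap0: "(\<lambda>i. K * (\<beta> i - \<alpha> i)) \<longlonglongrightarrow> 0"
  proof -
    have "(\<lambda>i. (1 / real q) ^ i) \<longlonglongrightarrow> 0" using q1 by (intro LIMSEQ_power_zero) simp
    then have "(\<lambda>i. (1 / real q) ^ i * (K / real q ^ L)) \<longlonglongrightarrow> 0"
      by (intro tendsto_mult_left_zero)
    then show ?thesis by (simp add: gap power_add power_divide)
  qed
  have "\<alpha> \<longlonglongrightarrow> y" "\<beta> \<longlonglongrightarrow> y"
    using near by (intro LIM_zero_cancel[where f = \<alpha>] LIM_zero_cancel[where f = \<beta>]
        Lim_null_comparison[OF _ gap0] always_eventually allI; simp)+

  obtain D where D: "(F has_field_derivative D) (at y)"
  proof -
    have lx: "log q y = x" using q1 by (simp add: y_def)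
    obtain P where "(\<Psi> has_field_derivative P) (at x)"
      using diff by (auto simp: real_differentiable_def)
    then have "(\<Psi> has_field_derivative P) (at (log q y))" by (simp add: lx)
    moreover have "(log q has_field_derivative 1 / (ln q * y)) (at y)"
      using DERIV_log[OF y0] by simp
    ultimately have "((\<lambda>u. \<Psi> (log q u)) has_field_derivative P * (1 / (ln q * y))) (at y)"
      by (rule DERIV_chain2)
    then show thesis
      using y0 by (intro that) (unfold F_def[abs_def], auto intro!: derivative_eq_intros)
  qed
  have "\<alpha> i < \<beta> i" for i
    using q1 by (simp add: \<alpha>_def \<beta>_def divide_strict_right_mono)
  from difference_quotient_tendsto[OF D \<open>\<alpha> \<longlonglongrightarrow> y\<close> \<open>\<beta> \<longlonglongrightarrow> y\<close> this near]
  have quot: "(\<lambda>i. (F (\<beta> i) - F (\<alpha> i)) / (\<beta> i - \<alpha> i)) \<longlonglongrightarrow> D" .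

  \<comment> \<open>Scaling by \<open>q ^ (i + L)\<close> turns the increment of \<open>F\<close>
    from \<open>c i\<close> to \<open>c i + 1\<close> into a difference quotient near
    \<open>y\<close> plus \<open>(i + L) * e\<close>.\<close>
  have rel: "real (i + L) * e - b (a i) = \<kappa> - (F (\<beta> i) - F (\<alpha> i)) / (\<beta> i - \<alpha> i)"
    if "i \<ge> i0" for i
  proof -
    let ?Q = "real q ^ (i + L)"
    have Q: "?Q > 0" using q1 by simp
    have c0: "c i > 0" using i0[OF that] q by (simp add: c_def)
    have pos: "\<alpha> i > 0" "\<beta> i > 0" using Q c0 by (auto simp: \<alpha>_def \<beta>_def)
    have "?Q * \<alpha> i = real (c i)" "?Q * \<beta> i = real (c i) + 1"
      using Q by (auto simp: \<alpha>_def \<beta>_def)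
    then have "F (real (c i)) = ?Q * F (\<alpha> i) + real (i + L) * e * real (c i)"
      "F (real (c i) + 1) = ?Q * F (\<beta> i) + real (i + L) * e * (real (c i) + 1)"
      using F_scale[OF pos(1), of "i + L"] F_scale[OF pos(2), of "i + L"]
      by (metis distrib_left mult.left_commute)+
    then show ?thesis using const[OF that] unfolding gap by (simp add: algebra_simps)
  qed
  have "(\<lambda>i. real (i + L) * e - b (a i)) \<longlonglongrightarrow> \<kappa> - D"
  proof (rule Lim_transform_eventually)
    show "(\<lambda>i. \<kappa> - (F (\<beta> i) - F (\<alpha> i)) / (\<beta> i - \<alpha> i)) \<longlonglongrightarrow> \<kappa> - D"
      by (intro tendsto_intros quot)
    show "\<forall>\<^sub>F i in sequentially. \<kappa> - (F (\<beta> i) - F (\<alpha> i)) / (\<beta> i - \<alpha> i)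
        = real (i + L) * e - b (a i)"
      unfolding eventually_sequentially by (intro exI[of _ i0] allI impI rel[symmetric])
  qed
  \<comment> \<open>Subtracting consecutive terms removes the unknown limit and the linear growth,
    leaving one \<open>e\<close> against a difference of integers.\<close>
  from tendsto_diff[OF LIMSEQ_Suc[OF this] this]
  have "(\<lambda>i. e - (b (a (Suc i)) - b (a i))) \<longlonglongrightarrow> 0"
    by (simp add: algebra_simps)
  from tendsto_diff[OF tendsto_const[of e] this]
  have "(\<lambda>i. b (a (Suc i)) - b (a i)) \<longlonglongrightarrow> e" by simp
  then show "e \<in> \<int>"
    by (rule closed_sequentially[OF closed_Ints, rotated]) (intro Ints_diff b)
qed

section \<open>Reduction of the theorem to the analytic lemma\<close>

theorem theorem2p8:
  fixes q :: nat and T :: transducer and \<Psi>\<^sub>1 :: "real \<Rightarrow> real"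
  assumes "q \<ge> 2"
    and "is_transducer q T"
    and "integer_outputs q T"
    and "\<exists>w. is_reset_sequence q T w"
    and "is_Psi1 q T \<Psi>\<^sub>1"
    and "e_T q T \<notin> \<int>"
  shows "\<forall>x::real. \<not> \<Psi>\<^sub>1 differentiable (at x)"
proof (intro allI notI)
  fix x :: real
  assume diff: "\<Psi>\<^sub>1 differentiable (at x)"
  define S where "S N = (\<Sum>n<N. output_sum q T n)" for N
  define g where "g N = complex_of_real (mean_output q T N)
      - e_T q T * complex_of_real (log (real q) (real N))
      - complex_of_real (\<Psi>\<^sub>1 (log (real q) (real N)))" for N
  obtain w where w: "is_reset_sequence q T w" using assms(4) by blast
  then obtain r where wq: "set w \<subseteq> {..<q}" and r: "\<And>s. s < nstates T \<Longrightarrow> foldl (step T) s w = r"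
    by (auto simp: is_reset_sequence_def)
  have q0: "q > 0" and q1: "real q > 1" using assms(1) by auto
  have "r < nstates T"
    using foldl_step_in[OF assms(2) _ wq] r assms(2) by (metis is_transducer_def)
  have per: "\<Psi>\<^sub>1 (x + 1) = \<Psi>\<^sub>1 x" for x
    using assms(5) final_period_eq_1[OF assms(2) q0 w] by (simp add: is_Psi1_def)
  obtain \<xi> where \<xi>: "\<xi> > 0" and O: "(\<lambda>N. norm (g N)) \<in> O(\<lambda>N. real N powr (-\<xi>) * ln (real N))"
    using assms(5) unfolding is_Psi1_def g_def by blast
  have lim0: "(\<lambda>N::nat. real N powr (-\<xi>) * ln (real N)) \<longlonglongrightarrow> 0"
    using \<xi> lim_ln_over_power[of \<xi>] by (simp add: powr_minus divide_inverse mult.commute)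
  have "(\<lambda>N::nat. real N powr (-\<xi>) * ln (real N)) \<in> o(\<lambda>_. 1)"
    by (rule smalloI_tendsto) (use lim0 in auto)
  with O have "(\<lambda>N. norm (g N)) \<in> o(\<lambda>_. 1)" by (rule landau_o.big_small_trans)
  from smalloD_tendsto[OF this] have g0: "g \<longlonglongrightarrow> 0"
    by (simp add: tendsto_norm_zero_iff)
  \<comment> \<open>Reality of the constant is read off from the expansion itself: all other terms
    of \<open>g\<close> are real, so a nonzero imaginary part would force \<open>log q N\<close> to
    tend to 0, which fails along the powers of \<open>q\<close>.\<close>
  have "Im (e_T q T) = 0"
  proof (rule ccontr)
    assume "Im (e_T q T) \<noteq> 0"
    have "(\<lambda>N. Im (g N)) \<longlonglongrightarrow> 0" using tendsto_Im[OF g0] by simp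
    then have "(\<lambda>N. Im (g N) * (- 1 / Im (e_T q T))) \<longlonglongrightarrow> 0" by (rule tendsto_mult_left_zero)
    moreover have "Im (g N) * (- 1 / Im (e_T q T)) = log q N" for N
      using \<open>Im (e_T q T) \<noteq> 0\<close> by (simp add: g_def field_simps)
    ultimately have "(\<lambda>N. log q (real N)) \<longlonglongrightarrow> 0" by simp
    from LIMSEQ_subseq_LIMSEQ[OF this, of "\<lambda>k. q ^ Suc k"]
    have "(\<lambda>k. log q (real (q ^ Suc k))) \<longlonglongrightarrow> 0"
      using assms(1) by (simp add: strict_mono_def o_def)
    moreover have "log q (real (q ^ Suc k)) = real (Suc k)" for k
      using q1 log_nat_power[of q q "Suc k"] by (simp only: of_nat_power) simp
    ultimately have "(\<lambda>k. real (Suc k)) \<longlonglongrightarrow> 0" by simp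
    from LIMSEQ_D[OF this, of 1] show False by force
  qed
  then have e: "e_T q T = complex_of_real (Re (e_T q T))" by (simp add: complex_eq_iff)
  have S: "(\<lambda>N. S N / real N - Re (e_T q T) * log q N - \<Psi>\<^sub>1 (log q N)) \<longlonglongrightarrow> 0"
    using tendsto_Re[OF g0] \<open>Im (e_T q T) = 0\<close> by (simp add: g_def mean_output_def S_def)
  obtain d where block: "\<And>j a. a > 0 \<Longrightarrow>
    S ((a * q ^ length w + horner_sum id q w + 1) * q ^ j)
    - S ((a * q ^ length w + horner_sum id q w) * q ^ j)
    = d j + real q ^ j * output_from T r (digits q a)"
    using block_sum_reset[OF assms(1,2) wq r] unfolding S_def by blast
  have "output_from T r (digits q a) \<in> \<int>" for a
    using output_from_Ints[OF assms(2,3) \<open>r < nstates T\<close> set_digits] .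
  from growth_constant_Ints[OF assms(1) S per block this diff]
  have "e_T q T \<in> \<int>" by (subst e) (auto elim!: Ints_cases)
  with assms(6) show False ..
qed

end
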